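(* Let $p,r,s\ge1$ and let $1\le a_1\le\cdots\le a_r$ and $1\le b_1\le\cdots\le b_s$ be integers. The tree $T=T^{p,0}(a_1,\dots,a_r;b_1,\dots,b_s)$ does not have exactly three main eigenvalues.
   Context: All graphs are finite, simple and undirected. An eigenvalue $\lambda$ of the adjacency matrix of a graph $G$ is a main eigenvalue if its eigenspace is not orthogonal to the all-ones vector $\mathbf j$; the number of main eigenvalues counts distinct ones. For integers $r,s\ge1$, $p,q\ge 0$, $1\le a_1\le\cdots\le a_r$, $1\le b_1\le\cdots\le b_s$, the tree $T^{p,q}(a_1,\dots,a_r;b_1,\dots,b_s)$ (of diameter 5) consists of two adjacent vertices $u_1,u_2$; vertices $w_1,\dots,w_r$ adjacent to $u_1$, where $w_i$ is additionally adjacent to $a_i$ pendant vertices; vertices $z_1,\dots,z_s$ adjacent to $u_2$, where $z_j$ is additionally adjacent to $b_j$ pendant vertices; $p$ pendant vertices adjacent to $u_1$; and $q$ pendant vertices adjacent to $u_2$. There are no other vertices or edges. *)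

theory Defs
  imports "Jordan_Normal_Form.Char_Poly" "Graph_Theory.Pair_Digraph"
begin

section \<open>Main eigenvalues of a graph\<close>

text \<open>
  Finite simple undirected graphs are those satisfying \<^locale>\<open>pair_graph\<close>: finite, loop-free, and
  with a symmetric arc set. The rows and columns of the adjacency matrix follow an enumeration
  \<open>vs\<close> of the vertices, intended to satisfy \<open>distinct vs\<close> and \<open>set vs = pverts G\<close>.
\<close>

definition adjacency_matrix :: "'v pair_pre_digraph \<Rightarrow> 'v list \<Rightarrow> real mat" where
  "adjacency_matrix G vs =
     mat (length vs) (length vs) (\<lambda>(i, j). if (vs ! i, vs ! j) \<in> parcs G then 1 else 0)"

definition all_ones :: "nat \<Rightarrow> real vec" where
  "all_ones n = vec n (\<lambda>_. 1)"

definition eigenspace :: "real mat \<Rightarrow> real \<Rightarrow> real vec set" where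
  "eigenspace A k = {v \<in> carrier_vec (dim_row A). A *\<^sub>v v = k \<cdot>\<^sub>v v}"

definition main_eigenvalue :: "real mat \<Rightarrow> real \<Rightarrow> bool" where
  "main_eigenvalue A k \<longleftrightarrow>
     eigenvalue A k \<and> \<not> (\<forall>v \<in> eigenspace A k. v \<bullet> all_ones (dim_row A) = 0)"

section \<open>The trees of diameter 5\<close>

text \<open>
  The parameter lists \<open>a\<close> and \<open>b\<close> are indexed from 0. \<open>PW i k\<close> is the \<open>k\<close>-th pendant vertex
  at \<open>W i\<close>, \<open>PZ j k\<close> the one at \<open>Z j\<close>, and \<open>P k\<close>, \<open>Q k\<close> are the pendant vertices at \<open>U1\<close>, \<open>U2\<close>.
\<close>

datatype vertex = U1 | U2 | W nat | Z nat | PW nat nat | PZ nat nat | P nat | Q nat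

definition tree_verts :: "nat \<Rightarrow> nat \<Rightarrow> nat list \<Rightarrow> nat list \<Rightarrow> vertex set" where
  "tree_verts p q a b =
     {U1, U2}
     \<union> {W i | i. i < length a} \<union> {PW i k | i k. i < length a \<and> k < a ! i}
     \<union> {Z j | j. j < length b} \<union> {PZ j k | j k. j < length b \<and> k < b ! j}
     \<union> {P k | k. k < p} \<union> {Q k | k. k < q}"

text \<open>Each edge is listed here in one orientation only.\<close>

definition tree_edges :: "nat \<Rightarrow> nat \<Rightarrow> nat list \<Rightarrow> nat list \<Rightarrow> (vertex \<times> vertex) set" where
  "tree_edges p q a b =
     {(U1, U2)}
     \<union> {(U1, W i) | i. i < length a} \<union> {(W i, PW i k) | i k. i < length a \<and> k < a ! i}
     \<union> {(U2, Z j) | j. j < length b} \<union> {(Z j, PZ j k) | j k. j < length b \<and> k < b ! j}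
     \<union> {(U1, P k) | k. k < p} \<union> {(U2, Q k) | k. k < q}"

definition tree_diam5 :: "nat \<Rightarrow> nat \<Rightarrow> nat list \<Rightarrow> nat list \<Rightarrow> vertex pair_pre_digraph" where
  "tree_diam5 p q a b =
     \<lparr>pverts = tree_verts p q a b, parcs = tree_edges p q a b \<union> (tree_edges p q a b)\<inverse>\<rparr>"

lemma finite_tree_verts: "finite (tree_verts p q a b)"
proof -
  have "{PW i k | i k. i < length a \<and> k < a ! i} = (\<Union>i<length a. PW i ` {..<a ! i})"
    and "{PZ j k | j k. j < length b \<and> k < b ! j} = (\<Union>j<length b. PZ j ` {..<b ! j})"
    by auto
  then show ?thesis
    by (simp add: tree_verts_def)
qed

lemma pair_graph_tree_diam5: "pair_graph (tree_diam5 p q a b)"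
proof -
  let ?V = "tree_verts p q a b" and ?E = "tree_edges p q a b"
  have sub: "?E \<subseteq> ?V \<times> ?V"
    by (auto simp: tree_edges_def tree_verts_def)
  moreover have "finite (?V \<times> ?V)"
    using finite_tree_verts by blast
  ultimately have "finite ?E"
    by (rule finite_subset)
  moreover have "(u, u) \<notin> ?E" for u
    by (auto simp: tree_edges_def)
  moreover have "sym (?E \<union> ?E\<inverse>)"
    by (rule sym_Un_converse)
  ultimately show ?thesis
    using sub finite_tree_verts[of p q a b]
    apply unfold_locales
    apply (auto simp: tree_diam5_def symmetric_def arcs_ends_def arc_to_ends_def)
    done
qed

end

theory Submission
  imports Defs "Jordan_Normal_Form.Schur_Decomposition"
begin

text \<open>
  Let \<open>A\<close> be the adjacency matrix and \<open>j\<close> the all-ones vector. Expanding \<open>j\<close> in eigenvectors of the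
  symmetric matrix \<open>A\<close>, only main eigenvalues contribute, so the product of the factors \<open>A - k\<close>,
  \<open>k\<close> running over the main eigenvalues, annihilates \<open>j\<close> (\<open>main_eigenvalues_annihilate\<close>). Since
  \<open>A\<^sup>k j\<close> lists the numbers of walks of length \<open>k\<close> from the vertices, three main
  eigenvalues yield constants \<open>c\<close>, \<open>c2\<close>, \<open>c3\<close> such that at every vertex the numbers \<open>w\<close> of walks satisfy
  \<open>w\<^sub>3 = c w\<^sub>2 + c2 w\<^sub>1 + c3\<close> (\<open>three_main_eigenvalues_walk_recurrence\<close>).

  In the tree this recurrence, read at one vertex of each kind, is an overdetermined system. Put
  \<open>n = r + p\<close>. Comparing \<open>W i\<close> with the pendant vertices at \<open>U1\<close> shows that all \<open>a\<^sub>i\<close> have one value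
  \<open>\<alpha>\<close>, and the pendant vertices at \<open>W i\<close> help to express \<open>c2\<close> and \<open>c3\<close> by \<open>c\<close>; then \<open>c \<noteq> 1\<close>, so
  all \<open>b\<^sub>j\<close> have one value \<open>\<beta>\<close>, and comparing the remaining equations gives
  \<open>n = c \<alpha>\<close>, \<open>s = \<alpha> + (c - 1) \<beta>\<close> and \<open>c \<beta> = (c - 1)\<^sup>2\<close>.
  Eliminating \<open>c\<close> gives \<open>n\<^sup>2 + \<alpha>\<^sup>2 = (\<beta> + 2) n \<alpha>\<close> in positive integers. Such an equation
  forces the factor \<open>\<beta> + 2\<close> to be 2 (\<open>sum_squares_eq_mult_prod\<close>), against \<open>\<beta> \<ge> 1\<close>.
\<close>

section \<open>Vectors orthogonal to all eigenvectors\<close>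

lemma symmetric_mat_scalar_prod:
  fixes A :: "'a :: comm_semiring_0 mat"
  assumes "A \<in> carrier_mat n n" "transpose_mat A = A" "v \<in> carrier_vec n" "w \<in> carrier_vec n"
  shows "(A *\<^sub>v v) \<bullet> w = v \<bullet> (A *\<^sub>v w)"
  using transpose_vec_mult_scalar[of A n n w v] assms by (metis comm_scalar_prod mult_mat_vec_carrier)

lemma shifted_mat_vec_carrier:
  fixes A :: "'a :: comm_ring_1 mat"
  assumes "A \<in> carrier_mat n n" "v \<in> carrier_vec n"
  shows "A *\<^sub>v v - k \<cdot>\<^sub>v v \<in> carrier_vec n"
  using assms by auto

lemma shifted_scalar_prod_eigenvector:
  fixes A :: "'a :: comm_ring_1 mat"
  assumes A: "A \<in> carrier_mat n n" "transpose_mat A = A"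
    and v: "v \<in> carrier_vec n" and w: "w \<in> carrier_vec n" "A *\<^sub>v w = e \<cdot>\<^sub>v w"
  shows "(A *\<^sub>v v - k \<cdot>\<^sub>v v) \<bullet> w = (e - k) * (v \<bullet> w)"
proof -
  have "(A *\<^sub>v v - k \<cdot>\<^sub>v v) \<bullet> w = (A *\<^sub>v v) \<bullet> w - (k \<cdot>\<^sub>v v) \<bullet> w"
    by (rule minus_scalar_prod_distrib[of _ n]) (use A v w in auto)
  also have "(A *\<^sub>v v) \<bullet> w = e * (v \<bullet> w)"
    using symmetric_mat_scalar_prod[OF A v w(1)] v w by simp
  also have "(k \<cdot>\<^sub>v v) \<bullet> w = k * (v \<bullet> w)"
    using v w by simp
  finally show ?thesis by (simp add: algebra_simps)
qed

lemma conjugate_mult_mat_vec_real: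
  fixes A :: "complex mat"
  assumes A: "A \<in> carrier_mat n n" and real: "\<And>i j. i < n \<Longrightarrow> j < n \<Longrightarrow> cnj (A $$ (i, j)) = A $$ (i, j)"
    and v: "v \<in> carrier_vec n"
  shows "A *\<^sub>v conjugate v = conjugate (A *\<^sub>v v)"
proof (rule eq_vecI)
  show "dim_vec (A *\<^sub>v conjugate v) = dim_vec (conjugate (A *\<^sub>v v))" by simp
  fix i assume "i < dim_vec (conjugate (A *\<^sub>v v))"
  then have i: "i < n" using A by simp
  show "(A *\<^sub>v conjugate v) $ i = conjugate (A *\<^sub>v v) $ i"
    using A v i real by (auto simp: scalar_prod_def intro!: sum.cong)
qed

text \<open>
  A triangularization \<open>A P = P B\<close> over the complex numbers stands in for an eigenbasis.
  Write the products of \<open>u\<close> with the columns of \<open>P\<close> as a row vector \<open>y\<close>. Replacing \<open>u\<close> by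
  \<open>(A - e) u\<close> replaces \<open>y\<close> by \<open>y (B - e)\<close>, and if \<open>y\<close> starts with \<open>k\<close> zeros and \<open>e\<close> is the \<open>k\<close>-th
  diagonal entry of \<open>B\<close>, the new row starts with one zero more. Orthogonality to all
  eigenvectors survives the replacement, so by downward induction on \<open>k\<close> the vector \<open>(A - e) u\<close>
  vanishes. Thus \<open>A u = e u\<close>, its conjugate is an eigenvector for \<open>cnj e\<close> as \<open>A\<close> is real, and
  orthogonality to it says that \<open>u\<close> has norm 0.
\<close>

lemma orthogonal_to_eigenvectors_zero_complex:
  fixes A :: "complex mat"
  assumes A: "A \<in> carrier_mat n n" and sym: "transpose_mat A = A"
    and real: "\<And>i j. i < n \<Longrightarrow> j < n \<Longrightarrow> cnj (A $$ (i, j)) = A $$ (i, j)"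
    and u: "u \<in> carrier_vec n"
    and orth: "\<And>w e. w \<in> carrier_vec n \<Longrightarrow> A *\<^sub>v w = e \<cdot>\<^sub>v w \<Longrightarrow> u \<bullet> w = 0"
  shows "u = 0\<^sub>v n"
proof -
  obtain es where "char_poly A = (\<Prod>a\<leftarrow>es. [:- a, 1:])"
    using char_poly_factorized[OF A] by blast
  then obtain B where B: "B \<in> carrier_mat n n" and tri: "upper_triangular B" and AB: "similar_mat A B"
    using schur_decomposition_exists[OF A] by blast
  obtain P Q where "similar_mat_wit A B P Q"
    using AB unfolding similar_mat_def by blast
  note wit = similar_mat_witD2[OF A this]
  have P: "P \<in> carrier_mat n n" and Q: "Q \<in> carrier_mat n n"
    and PQ: "P * Q = 1\<^sub>m n" and QP: "Q * P = 1\<^sub>m n" and AP: "A = P * B * Q"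
    using wit by auto
  have "A * P = P * B * (Q * P)"
    using AP assoc_mult_mat[of "P * B" n n Q n P n] P Q B by simp
  then have "A * P = P * B" using P B QP by simp
  then have "transpose_mat (A * P) = transpose_mat (P * B)" by simp
  then have PA: "transpose_mat P * A = transpose_mat B * transpose_mat P"
    using A P B sym by (simp add: transpose_mult)
  have "\<And>u. u \<in> carrier_vec n \<Longrightarrow>
      (\<And>w e. w \<in> carrier_vec n \<Longrightarrow> A *\<^sub>v w = e \<cdot>\<^sub>v w \<Longrightarrow> u \<bullet> w = 0) \<Longrightarrow>
      (\<And>i. i < k \<Longrightarrow> (transpose_mat P *\<^sub>v u) $ i = 0) \<Longrightarrow> u = 0\<^sub>v n"
    if "k \<le> n" for k
    using that
  proof (induction rule: inc_induct)
    case base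
    have "transpose_mat P *\<^sub>v u = 0\<^sub>v n" using base(3) P by auto
    moreover have "transpose_mat Q *\<^sub>v (transpose_mat P *\<^sub>v u) = (transpose_mat Q * transpose_mat P) *\<^sub>v u"
      by (rule assoc_mult_mat_vec[symmetric]) (use P Q base in auto)
    moreover have "transpose_mat Q * transpose_mat P = 1\<^sub>m n"
      using transpose_mult[OF P Q] PQ by simp
    moreover have "transpose_mat Q *\<^sub>v 0\<^sub>v n = 0\<^sub>v n"
      using Q by (intro eq_vecI) auto
    ultimately show ?case using base(1) by simp
  next
    case (step k)
    define e where "e = B $$ (k, k)"
    define u' where "u' = A *\<^sub>v u - e \<cdot>\<^sub>v u"
    define y where "y = transpose_mat P *\<^sub>v u"
    have y: "y \<in> carrier_vec n" unfolding y_def using P step by auto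
    have u': "u' \<in> carrier_vec n"
      unfolding u'_def by (rule shifted_mat_vec_carrier[OF A step(4)])
    \<comment> \<open>Here \<open>y\<close> vanishes before position \<open>k\<close>; the shift by \<open>e\<close> also clears position \<open>k\<close>.\<close>
    have "u' = 0\<^sub>v n"
    proof (rule step.IH[OF u'])
      fix w f assume w: "w \<in> carrier_vec n" "A *\<^sub>v w = f \<cdot>\<^sub>v w"
      show "u' \<bullet> w = 0"
        unfolding u'_def shifted_scalar_prod_eigenvector[OF A sym step(4) w] step(5)[OF w] by simp
    next
      fix i assume i: "i < Suc k"
      have "transpose_mat P *\<^sub>v u' = transpose_mat P *\<^sub>v (A *\<^sub>v u) - transpose_mat P *\<^sub>v (e \<cdot>\<^sub>v u)"
        unfolding u'_def by (rule mult_minus_distrib_mat_vec) (use P A step in auto)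
      also have "transpose_mat P *\<^sub>v (A *\<^sub>v u) = transpose_mat B *\<^sub>v y"
        unfolding y_def using PA P A B step(4)
        by (metis assoc_mult_mat_vec transpose_carrier_mat)
      also have "transpose_mat P *\<^sub>v (e \<cdot>\<^sub>v u) = e \<cdot>\<^sub>v y"
        unfolding y_def by (rule mult_mat_vec) (use P step in auto)
      finally have "(transpose_mat P *\<^sub>v u') $ i = (\<Sum>l<n. B $$ (l, i) * y $ l) - e * y $ i"
        using i step.hyps B y by (simp add: scalar_prod_def lessThan_atLeast0)
      also have "(\<Sum>l<n. B $$ (l, i) * y $ l) = (\<Sum>l<n. if l = i then e * y $ i else 0)"
      proof (rule sum.cong[OF refl])
        fix l assume l: "l \<in> {..<n}"
        show "B $$ (l, i) * y $ l = (if l = i then e * y $ i else 0)"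
        proof (cases "l < k")
          case True
          then show ?thesis using step(6) unfolding y_def by auto
        next
          case False
          with i l B tri step(6)[folded y_def] show ?thesis
            by (cases "l = i"; cases "l = k") (auto simp: e_def less_Suc_eq)
        qed
      qed
      also have "\<dots> = e * y $ i" using i step.hyps by simp
      finally show "(transpose_mat P *\<^sub>v u') $ i = 0" by simp
    qed
    then have "A *\<^sub>v u = e \<cdot>\<^sub>v u"
      using A step(4) unfolding u'_def
      by (auto simp: vec_eq_iff)
    then have "A *\<^sub>v conjugate u = cnj e \<cdot>\<^sub>v conjugate u"
      using conjugate_mult_mat_vec_real[OF A real step(4)]
      by (simp add: conjugate_smult_vec)
    then have "u \<bullet>c u = 0"
      using step(5)[of "conjugate u"] step(4) by simp
    then show ?case using step(4) by simp
  qed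
  from this[of 0 u] show ?thesis using u orth by auto
qed

text \<open>
  This passes from complex to real eigenvectors: an eigenvalue of a real symmetric matrix is real,
  hence the real and imaginary parts of a complex eigenvector are real eigenvectors (or zero) for
  the same eigenvalue.
\<close>

lemma orthogonal_to_eigenvectors_zero:
  fixes A :: "real mat"
  assumes A: "A \<in> carrier_mat n n" and sym: "transpose_mat A = A"
    and v: "v \<in> carrier_vec n"
    and orth: "\<And>w e. w \<in> carrier_vec n \<Longrightarrow> A *\<^sub>v w = e \<cdot>\<^sub>v w \<Longrightarrow> v \<bullet> w = 0"
  shows "v = 0\<^sub>v n"
proof -
  define C where "C = map_mat complex_of_real A"
  define u where "u = map_vec complex_of_real v"
  have C: "C \<in> carrier_mat n n" and Csym: "transpose_mat C = C"
    and Creal: "\<And>i j. i < n \<Longrightarrow> j < n \<Longrightarrow> cnj (C $$ (i, j)) = C $$ (i, j)"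
    unfolding C_def using A sym by (auto simp: map_mat_transpose)
  have u: "u \<in> carrier_vec n" unfolding u_def using v by simp
  have "u = 0\<^sub>v n"
  proof (rule orthogonal_to_eigenvectors_zero_complex[OF C Csym Creal u])
    fix w e assume w: "w \<in> carrier_vec n" "C *\<^sub>v w = e \<cdot>\<^sub>v w"
    show "u \<bullet> w = 0"
    proof (cases "w = 0\<^sub>v n")
      case True then show ?thesis using u by simp
    next
      case False
      have "C *\<^sub>v conjugate w = cnj e \<cdot>\<^sub>v conjugate w"
        using conjugate_mult_mat_vec_real[OF C Creal w(1)] w(2) by (simp add: conjugate_smult_vec)
      \<comment> \<open>Both sides are \<open>(C w) \<bullet>c w\<close>, once with \<open>C\<close> moved to the second argument.\<close>
      then have "e * (w \<bullet>c w) = cnj e * (w \<bullet>c w)"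
        using symmetric_mat_scalar_prod[OF C Csym w(1), of "conjugate w"] w by simp
      then have "e = cnj e" using False w(1) by simp
      then have e: "Im e = 0" by (simp add: complex_eq_iff)
      define x where "x = map_vec Re w"
      define y where "y = map_vec Im w"
      have x: "x \<in> carrier_vec n" and y: "y \<in> carrier_vec n" unfolding x_def y_def using w by auto
      have row: "(\<Sum>j<n. complex_of_real (A $$ (i, j)) * w $ j) = e * w $ i" if "i < n" for i
        using arg_cong[OF w(2), of "\<lambda>z. z $ i"] that A w(1)
        by (simp add: C_def scalar_prod_def lessThan_atLeast0)
      have "A *\<^sub>v x = Re e \<cdot>\<^sub>v x"
      proof (rule eq_vecI)
        fix i assume "i < dim_vec (Re e \<cdot>\<^sub>v x)"
        then have i: "i < n" using x by simp
        show "(A *\<^sub>v x) $ i = (Re e \<cdot>\<^sub>v x) $ i"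
          using arg_cong[OF row[OF i], of Re] A i w(1) e
          by (simp add: x_def scalar_prod_def lessThan_atLeast0)
      qed (use A x in auto)
      moreover have "A *\<^sub>v y = Re e \<cdot>\<^sub>v y"
      proof (rule eq_vecI)
        fix i assume "i < dim_vec (Re e \<cdot>\<^sub>v y)"
        then have i: "i < n" using y by simp
        show "(A *\<^sub>v y) $ i = (Re e \<cdot>\<^sub>v y) $ i"
          using arg_cong[OF row[OF i], of Im] A i w(1) e
          by (simp add: y_def scalar_prod_def lessThan_atLeast0)
      qed (use A y in auto)
      ultimately have "v \<bullet> x = 0" "v \<bullet> y = 0" using orth x y by auto
      then show ?thesis
        using v w(1) by (simp add: complex_eq_iff u_def x_def y_def scalar_prod_def)
    qed
  qed
  then show ?thesis
    using v unfolding u_def by (auto simp: vec_eq_iff)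
qed

section \<open>Main eigenvalues and numbers of walks\<close>

text \<open>
  By symmetry, the product with an eigenvector \<open>w\<close> for \<open>e\<close> is \<open>(\<Prod>k. e - k) * (j \<bullet> w)\<close>, where \<open>j\<close> is
  the all-ones vector. If \<open>j \<bullet> w \<noteq> 0\<close> then \<open>e\<close> is a main eigenvalue, so one of the factors is zero.
  Hence the vector is orthogonal to every eigenvector.
\<close>

lemma main_eigenvalues_annihilate:
  fixes A :: "real mat"
  assumes A: "A \<in> carrier_mat n n" and sym: "transpose_mat A = A"
    and main: "{k. main_eigenvalue A k} \<subseteq> set ks"
  shows "foldr (\<lambda>k v. A *\<^sub>v v - k \<cdot>\<^sub>v v) ks (all_ones n) = 0\<^sub>v n"
proof (rule orthogonal_to_eigenvectors_zero[OF A sym])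
  have ones: "all_ones n \<in> carrier_vec n" by (simp add: all_ones_def)
  show carrier: "foldr (\<lambda>k v. A *\<^sub>v v - k \<cdot>\<^sub>v v) ks (all_ones n) \<in> carrier_vec n" for ks
    by (induction ks) (use A ones in auto)
  fix w e assume w: "w \<in> carrier_vec n" "A *\<^sub>v w = e \<cdot>\<^sub>v w"
  have prod: "foldr (\<lambda>k v. A *\<^sub>v v - k \<cdot>\<^sub>v v) ks (all_ones n) \<bullet> w = (\<Prod>k\<leftarrow>ks. e - k) * (all_ones n \<bullet> w)" for ks
    by (induction ks) (simp_all add: shifted_scalar_prod_eigenvector[OF A sym carrier w])
  show "foldr (\<lambda>k v. A *\<^sub>v v - k \<cdot>\<^sub>v v) ks (all_ones n) \<bullet> w = 0"
  proof (cases "all_ones n \<bullet> w = 0")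
    case True then show ?thesis by (simp add: prod)
  next
    case False
    have "w \<noteq> 0\<^sub>v n" using False ones by auto
    then have "eigenvalue A e"
      using w A unfolding eigenvalue_def eigenvector_def by auto
    moreover have "w \<in> eigenspace A e" using w A by (simp add: eigenspace_def)
    moreover have "w \<bullet> all_ones n \<noteq> 0" using False comm_scalar_prod[OF ones w(1)] by simp
    ultimately have "main_eigenvalue A e"
      using A by (auto simp: main_eigenvalue_def)
    then have "e \<in> set ks" using main by auto
    then show ?thesis by (auto simp: prod prod_list_zero_iff)
  qed
qed

fun walks :: "'v pair_pre_digraph \<Rightarrow> nat \<Rightarrow> 'v \<Rightarrow> real" where
  "walks G 0 v = 1"
| "walks G (Suc k) v = (\<Sum>u | (v, u) \<in> parcs G. walks G k u)"

lemma adjacency_matrix_mult: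
  assumes G: "pair_graph G" and vs: "distinct vs" "set vs = pverts G"
  shows "adjacency_matrix G vs *\<^sub>v vec (length vs) (\<lambda>i. f (vs ! i)) =
    vec (length vs) (\<lambda>i. \<Sum>u | (vs ! i, u) \<in> parcs G. f u)"
proof (rule eq_vecI)
  interpret pair_graph G by fact
  fix i assume "i < dim_vec (vec (length vs) (\<lambda>i. \<Sum>u | (vs ! i, u) \<in> parcs G. f u))"
  then have i: "i < length vs" by simp
  have "(adjacency_matrix G vs *\<^sub>v vec (length vs) (\<lambda>i. f (vs ! i))) $ i =
      (\<Sum>j<length vs. if (vs ! i, vs ! j) \<in> parcs G then f (vs ! j) else 0)"
    using i by (auto simp: adjacency_matrix_def scalar_prod_def lessThan_atLeast0 intro!: sum.cong)
  also have "\<dots> = (\<Sum>u\<in>set vs. if (vs ! i, u) \<in> parcs G then f u else 0)"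
    by (rule sum.reindex_bij_betw[OF bij_betw_nth]) (use vs in auto)
  also have "\<dots> = (\<Sum>u \<in> set vs \<inter> {u. (vs ! i, u) \<in> parcs G}. f u)"
    by (subst sum.inter_restrict) auto
  also have "set vs \<inter> {u. (vs ! i, u) \<in> parcs G} = {u. (vs ! i, u) \<in> parcs G}"
    using vs(2) in_arcsD2 by auto
  finally show "(adjacency_matrix G vs *\<^sub>v vec (length vs) (\<lambda>i. f (vs ! i))) $ i =
    vec (length vs) (\<lambda>i. \<Sum>u | (vs ! i, u) \<in> parcs G. f u) $ i"
    using i by simp
qed (simp add: adjacency_matrix_def)

lemma adjacency_matrix_symmetric:
  assumes "pair_graph G"
  shows "transpose_mat (adjacency_matrix G vs) = adjacency_matrix G vs"
proof -
  interpret pair_graph G by fact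
  have "(u, v) \<in> parcs G \<longleftrightarrow> (v, u) \<in> parcs G" for u v
    using arcs_symmetric by blast
  then show ?thesis
    by (intro eq_matI) (auto simp: adjacency_matrix_def)
qed

lemma three_main_eigenvalues_walk_recurrence:
  assumes G: "pair_graph G" and vs: "distinct vs" "set vs = pverts G"
    and card3: "card {k. main_eigenvalue (adjacency_matrix G vs) k} = 3"
  obtains c1 c2 c3 where
    "\<And>v. v \<in> pverts G \<Longrightarrow> walks G 3 v = c1 * walks G 2 v + c2 * walks G 1 v + c3"
proof -
  let ?A = "adjacency_matrix G vs"
  define n where "n = length vs"
  define W where "W k = vec n (\<lambda>i. walks G k (vs ! i))" for k
  have A: "?A \<in> carrier_mat n n" by (simp add: adjacency_matrix_def n_def)
  have AW: "?A *\<^sub>v W k = W (Suc k)" for k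
    unfolding W_def n_def adjacency_matrix_mult[OF G vs] by simp
  have W: "W k \<in> carrier_vec n" for k by (simp add: W_def)
  obtain x y z where xyz: "{k. main_eigenvalue ?A k} = {x, y, z}"
    using card3 by (auto simp: card_3_iff)
  define L where "L k v = ?A *\<^sub>v v - k \<cdot>\<^sub>v v" for k v
  have "foldr L [x, y, z] (all_ones n) = 0\<^sub>v n"
    using main_eigenvalues_annihilate[OF A adjacency_matrix_symmetric[OF G], of "[x, y, z]"] xyz
    by (simp add: L_def)
  moreover have "all_ones n = W 0" by (simp add: W_def all_ones_def)
  ultimately have LLL: "L x (L y (L z (W 0))) = 0\<^sub>v n" by simp
  have L1: "L z (W 0) = W 1 - z \<cdot>\<^sub>v W 0" by (simp add: L_def AW)
  have "L y (L z (W 0)) = ?A *\<^sub>v W 1 - ?A *\<^sub>v (z \<cdot>\<^sub>v W 0) - y \<cdot>\<^sub>v (W 1 - z \<cdot>\<^sub>v W 0)"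
    unfolding L1 unfolding L_def
    by (subst mult_minus_distrib_mat_vec[OF A]) (use W in auto)
  then have L2: "L y (L z (W 0)) = W 2 - z \<cdot>\<^sub>v W 1 - y \<cdot>\<^sub>v (W 1 - z \<cdot>\<^sub>v W 0)"
    by (simp add: mult_mat_vec[OF A W] AW numeral_2_eq_2)
  have "W 2 - z \<cdot>\<^sub>v W 1 - y \<cdot>\<^sub>v (W 1 - z \<cdot>\<^sub>v W 0) = W 2 - (y + z) \<cdot>\<^sub>v W 1 - (- y * z) \<cdot>\<^sub>v W 0"
    using W by (auto simp: vec_eq_iff W_def algebra_simps)
  with L2 have L2': "L y (L z (W 0)) = W 2 - (y + z) \<cdot>\<^sub>v W 1 - (- y * z) \<cdot>\<^sub>v W 0" by simp
  have "?A *\<^sub>v (W 2 - (y + z) \<cdot>\<^sub>v W 1 - (- y * z) \<cdot>\<^sub>v W 0) =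
      ?A *\<^sub>v (W 2 - (y + z) \<cdot>\<^sub>v W 1) - ?A *\<^sub>v ((- y * z) \<cdot>\<^sub>v W 0)"
    by (rule mult_minus_distrib_mat_vec[OF A]) (use W in auto)
  also have "?A *\<^sub>v (W 2 - (y + z) \<cdot>\<^sub>v W 1) = ?A *\<^sub>v W 2 - ?A *\<^sub>v ((y + z) \<cdot>\<^sub>v W 1)"
    by (rule mult_minus_distrib_mat_vec[OF A]) (use W in auto)
  finally have A2: "?A *\<^sub>v (W 2 - (y + z) \<cdot>\<^sub>v W 1 - (- y * z) \<cdot>\<^sub>v W 0) = W 3 - (y + z) \<cdot>\<^sub>v W 2 - (- y * z) \<cdot>\<^sub>v W 1"
    by (simp add: mult_mat_vec[OF A W] AW numeral_2_eq_2 numeral_3_eq_3)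
  have L3: "W 3 - (y + z) \<cdot>\<^sub>v W 2 - (- y * z) \<cdot>\<^sub>v W 1 -
      x \<cdot>\<^sub>v (W 2 - (y + z) \<cdot>\<^sub>v W 1 - (- y * z) \<cdot>\<^sub>v W 0) = 0\<^sub>v n"
    using LLL unfolding L_def[of x] L2' A2 .
  show thesis
  proof
    fix v assume "v \<in> pverts G"
    then have "v \<in> set vs" using vs(2) by simp
    then obtain i where i: "i < n" "vs ! i = v"
      unfolding in_set_conv_nth n_def by blast
    \<comment> \<open>The coefficients come from expanding \<open>(X - x) (X - y) (X - z)\<close>.\<close>
    show "walks G 3 v = (x + y + z) * walks G 2 v + (- (x * y + y * z + x * z)) * walks G 1 v + x * y * z"
      using arg_cong[OF L3, of "\<lambda>u. u $ i"] i
      by (simp add: W_def algebra_simps del: walks.simps(2))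
  qed
qed

section \<open>Walks in the trees of diameter 5\<close>

context
  fixes p q :: nat and a b :: "nat list" and T
  defines "T \<equiv> tree_diam5 p q a b"
begin

lemmas T_parcs = T_def tree_diam5_def tree_edges_def

lemma neighbours_U1:
  "{u. (U1, u) \<in> parcs T} = {U2} \<union> W ` {..<length a} \<union> P ` {..<p}"
  by (auto simp: T_parcs)

lemma neighbours_U2:
  "{u. (U2, u) \<in> parcs T} = {U1} \<union> Z ` {..<length b} \<union> Q ` {..<q}"
  by (auto simp: T_parcs)

lemma neighbours_W:
  "i < length a \<Longrightarrow> {u. (W i, u) \<in> parcs T} = {U1} \<union> PW i ` {..<a ! i}"
  by (auto simp: T_parcs)

lemma neighbours_Z:
  "j < length b \<Longrightarrow> {u. (Z j, u) \<in> parcs T} = {U2} \<union> PZ j ` {..<b ! j}"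
  by (auto simp: T_parcs)

lemma neighbours_pendant:
  "i < length a \<Longrightarrow> k < a ! i \<Longrightarrow> {u. (PW i k, u) \<in> parcs T} = {W i}"
  "j < length b \<Longrightarrow> k < b ! j \<Longrightarrow> {u. (PZ j k, u) \<in> parcs T} = {Z j}"
  "k < p \<Longrightarrow> {u. (P k, u) \<in> parcs T} = {U1}"
  "k < q \<Longrightarrow> {u. (Q k, u) \<in> parcs T} = {U2}"
  by (auto simp: T_parcs)

lemma walks_Suc:
  "walks T (Suc k) U1 = walks T k U2 + (\<Sum>i<length a. walks T k (W i)) + (\<Sum>l<p. walks T k (P l))"
  "walks T (Suc k) U2 = walks T k U1 + (\<Sum>j<length b. walks T k (Z j)) + (\<Sum>l<q. walks T k (Q l))"
  "i < length a \<Longrightarrow> walks T (Suc k) (W i) = walks T k U1 + (\<Sum>l<a ! i. walks T k (PW i l))"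
  "j < length b \<Longrightarrow> walks T (Suc k) (Z j) = walks T k U2 + (\<Sum>l<b ! j. walks T k (PZ j l))"
  "i < length a \<Longrightarrow> l < a ! i \<Longrightarrow> walks T (Suc k) (PW i l) = walks T k (W i)"
  "j < length b \<Longrightarrow> l < b ! j \<Longrightarrow> walks T (Suc k) (PZ j l) = walks T k (Z j)"
  "l < p \<Longrightarrow> walks T (Suc k) (P l) = walks T k U1"
  "l < q \<Longrightarrow> walks T (Suc k) (Q l) = walks T k U2"
proof -
  have disj: "W ` X \<inter> P ` Y = {}" "Z ` X \<inter> Q ` Y = {}" for X Y by auto
  show "walks T (Suc k) U1 = walks T k U2 + (\<Sum>i<length a. walks T k (W i)) + (\<Sum>l<p. walks T k (P l))"
    and "walks T (Suc k) U2 = walks T k U1 + (\<Sum>j<length b. walks T k (Z j)) + (\<Sum>l<q. walks T k (Q l))"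
    by (simp_all add: neighbours_U1 neighbours_U2 image_iff sum.union_disjoint disj sum.reindex inj_on_def)
qed (simp_all add: neighbours_W neighbours_Z neighbours_pendant image_iff sum.reindex inj_on_def)

end

section \<open>The arithmetic of the parameters\<close>

text \<open>
  After cancelling the gcd, \<open>x\<close> divides \<open>y\<^sup>2\<close> and \<open>y\<close> divides \<open>x\<^sup>2\<close>, so both are 1. Equivalently,
  a positive rational root of \<open>X\<^sup>2 - k X + 1\<close> is 1.
\<close>

lemma sum_squares_eq_mult_prod:
  fixes x y k :: nat
  assumes pos: "x > 0" "y > 0" and eq: "x\<^sup>2 + y\<^sup>2 = k * x * y"
  shows "k = 2"
proof -
  define g where "g = gcd x y"
  have "g \<noteq> 0" using pos by (simp add: g_def)
  then obtain x' y' where x: "x = x' * g" and y: "y = y' * g" and cop: "coprime x' y'"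
    using gcd_coprime_exists[of x y, folded g_def] by blast
  have "g\<^sup>2 * (x'\<^sup>2 + y'\<^sup>2) = g\<^sup>2 * (k * x' * y')"
    using eq unfolding x y by (simp add: algebra_simps power2_eq_square)
  then have eq': "x'\<^sup>2 + y'\<^sup>2 = k * x' * y'" using \<open>g \<noteq> 0\<close> by simp
  have "x' dvd x'\<^sup>2 + y'\<^sup>2" "y' dvd x'\<^sup>2 + y'\<^sup>2" unfolding eq' by simp_all
  moreover have "x' dvd x'\<^sup>2" "y' dvd y'\<^sup>2" by (simp_all add: power2_eq_square)
  ultimately have "x' dvd y'\<^sup>2" "y' dvd x'\<^sup>2"
    using dvd_add_right_iff dvd_add_left_iff by blast+
  moreover have "coprime x' (y'\<^sup>2)" "coprime y' (x'\<^sup>2)"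
    using cop by (simp_all add: coprime_commute)
  ultimately have "is_unit x'" "is_unit y'"
    by (simp_all only: coprime_absorb_left)
  then show ?thesis using eq' by simp
qed

theorem theorem3p8:
  fixes p r s :: nat and a b :: "nat list" and vs :: "vertex list"
  assumes "p \<ge> 1" and "r \<ge> 1" and "s \<ge> 1"
    and "length a = r" and "length b = s"
    and "sorted a" and "\<forall>x \<in> set a. 1 \<le> x"
    and "sorted b" and "\<forall>x \<in> set b. 1 \<le> x"
    and "distinct vs" and "set vs = pverts (tree_diam5 p 0 a b)"
  shows "card {k. main_eigenvalue (adjacency_matrix (tree_diam5 p 0 a b) vs) k} \<noteq> 3"
proof
  define T where "T = tree_diam5 p 0 a b"
  assume "card {k. main_eigenvalue (adjacency_matrix (tree_diam5 p 0 a b) vs) k} = 3"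
  then obtain c c2 c3 where rec:
    "\<And>v. v \<in> pverts T \<Longrightarrow>
      walks T (Suc (Suc (Suc 0))) v = c * walks T (Suc (Suc 0)) v + c2 * walks T (Suc 0) v + c3"
    using three_main_eigenvalues_walk_recurrence[OF pair_graph_tree_diam5 assms(10,11)]
    unfolding T_def numeral_3_eq_3 numeral_2_eq_2 One_nat_def by metis
  note walks_simps = walks_Suc[where p = p and q = 0 and a = a and b = b, folded T_def, unfolded assms(4,5)]
  define n where "n = r + p"
  have apos: "0 < a ! i" if "i < r" for i using assms(4,7) that by (auto simp: Suc_le_eq)
  have bpos: "0 < b ! j" if "j < s" for j using assms(5,9) that by (auto simp: Suc_le_eq)
  have in_T: "U2 \<in> pverts T" "P 0 \<in> pverts T"
    "\<And>i. i < r \<Longrightarrow> W i \<in> pverts T \<and> PW i 0 \<in> pverts T"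
    "\<And>j. j < s \<Longrightarrow> Z j \<in> pverts T \<and> PZ j 0 \<in> pverts T"
    using assms(1,4,5) apos bpos by (auto simp: T_def tree_diam5_def tree_verts_def Suc_le_eq)
  note [simp del] = walks.simps(2)
  define e1 where "e1 = walks T (Suc (Suc 0)) U1"
  define e2 where "e2 = walks T (Suc (Suc 0)) U2"
  have e1: "e1 = (\<Sum>i<r. real (a ! i)) + n + s + 1"
    by (simp add: e1_def walks_simps n_def sum.distrib)
  have e2: "e2 = (\<Sum>j<s. real (b ! j)) + s + n + 1"
    by (simp add: e2_def walks_simps n_def sum.distrib)
  have eqP: "e1 = c * (n + 1) + c2 + c3"
    using rec[OF in_T(2)] assms(1) by (simp add: e1_def walks_simps n_def)
  have eqW: "e1 + a ! i * (a ! i + 1) = c * (n + 1 + a ! i) + c2 * (a ! i + 1) + c3" if "i < r" for i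
    using rec[OF in_T(3)[OF that, THEN conjunct1]] that by (simp add: e1_def walks_simps n_def algebra_simps)
  have eqPW: "real n + 1 + a ! i = c * (a ! i + 1) + c2 + c3" if "i < r" for i
    using rec[OF in_T(3)[OF that, THEN conjunct2]] that apos[OF that]
    by (simp add: walks_simps n_def algebra_simps)
  have eqZ: "e2 + b ! j * (b ! j + 1) = c * (s + 1 + b ! j) + c2 * (b ! j + 1) + c3" if "j < s" for j
    using rec[OF in_T(4)[OF that, THEN conjunct1]] that by (simp add: e2_def walks_simps n_def algebra_simps)
  have eqPZ: "real s + 1 + b ! j = c * (b ! j + 1) + c2 + c3" if "j < s" for j
    using rec[OF in_T(4)[OF that, THEN conjunct2]] that bpos[OF that]
    by (simp add: walks_simps n_def algebra_simps)
  have eqU2: "e1 + (\<Sum>j<s. real s + 1 + b ! j) = c * e2 + c2 * (s + 1) + c3"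
    using rec[OF in_T(1)] by (simp add: e1_def e2_def walks_simps n_def algebra_simps sum.distrib)
  \<comment> \<open>Subtract the equation at \<open>P 0\<close>: this is where a pendant vertex at \<open>U1\<close> is essential.\<close>
  have a_eq: "real (a ! i) = c + c2 - 1" if "i < r" for i
  proof -
    have "real (a ! i) * (a ! i + 1) = a ! i * (c + c2)"
      using eqW[OF that] eqP by (simp add: algebra_simps)
    then show ?thesis using apos[OF that] by simp
  qed
  define \<alpha> where "\<alpha> = a ! 0"
  define \<beta> where "\<beta> = b ! 0"
  have \<alpha>: "\<alpha> \<ge> 1" "real \<alpha> = c + c2 - 1" and \<beta>: "\<beta> \<ge> 1"
    using apos[of 0] bpos[of 0] a_eq[of 0] assms(2,3) by (simp_all add: \<alpha>_def \<beta>_def)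
  have e1': "e1 = real r * \<alpha> + n + s + 1"
    using a_eq by (simp add: e1 \<alpha>(2))
  have c2: "c2 = \<alpha> + 1 - c" using \<alpha>(2) by simp
  have c3: "c3 = n - c * \<alpha>"
    using eqPW[of 0] assms(2) c2 by (simp add: \<alpha>_def algebra_simps)
  have K: "c * (real n - \<alpha>) = (real r - 1) * \<alpha> + s"
    using eqP unfolding e1' c2 c3 by (simp add: algebra_simps)
  have "c \<noteq> 1"
  proof
    assume "c = 1"
    then have "real n = s" using eqPZ[of 0] assms(3) c2 c3 by simp
    with K \<open>c = 1\<close> have "real r * \<alpha> = 0" by (simp add: algebra_simps)
    then show False using assms(2) \<alpha>(1) by simp
  qed
  have b_diff: "(c - 1) * (real \<alpha> - b ! j) = real n - s" if "j < s" for j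
    using eqPZ[OF that] unfolding c2 c3 by (simp add: algebra_simps)
  have b_eq: "b ! j = \<beta>" if "j < s" for j
  proof -
    have "(c - 1) * (real \<alpha> - b ! j) = (c - 1) * (real \<alpha> - b ! 0)"
      using b_diff[OF that] b_diff[of 0] assms(3) by simp
    then show ?thesis using \<open>c \<noteq> 1\<close> by (simp add: \<beta>_def)
  qed
  have e2': "e2 = real s * \<beta> + s + n + 1"
    using b_eq by (simp add: e2)
  have "s * (real s - \<alpha>) = s * ((c - 1) * \<beta>)"
    using eqU2 b_eq K unfolding e1' e2' c2 c3 by (simp add: algebra_simps)
  then have s: "real s = \<alpha> + (c - 1) * \<beta>" using assms(3) by simp
  have n: "real n = c * \<alpha>"
    using b_diff[of 0] assms(3) s by (simp add: \<beta>_def[symmetric] algebra_simps)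
  \<comment> \<open>Now \<open>c\<close> is known to be \<open>n / \<alpha>\<close>; the vertex \<open>Z 0\<close> gives a quadratic equation for it.\<close>
  have "\<beta> * (c * \<beta>) = \<beta> * (c - 1)\<^sup>2"
  proof -
    have "real s * \<beta> + \<beta> * (real \<beta> - \<alpha>) = (c - 1) * (real s - \<alpha>)"
      using eqZ[of 0] assms(3) unfolding e2' c2 c3 by (simp add: \<beta>_def[symmetric] algebra_simps)
    then show ?thesis unfolding s by (simp add: algebra_simps power2_eq_square)
  qed
  then have "c * \<beta> = (c - 1)\<^sup>2" using \<beta> by simp
  then have "\<alpha>\<^sup>2 * (c * \<beta>) = \<alpha>\<^sup>2 * (c - 1)\<^sup>2" by simp
  then have "real (n\<^sup>2 + \<alpha>\<^sup>2) = real ((\<beta> + 2) * n * \<alpha>)"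
    by (simp add: n algebra_simps power2_eq_square)
  then have "n\<^sup>2 + \<alpha>\<^sup>2 = (\<beta> + 2) * n * \<alpha>" by (simp only: of_nat_eq_iff)
  then have "\<beta> + 2 = 2"
    by (rule sum_squares_eq_mult_prod[rotated 2]) (use \<alpha>(1) assms(2) in \<open>auto simp: n_def\<close>)
  then show False using \<beta> by simp
qed

end
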